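(* Let $m,n\ge 1$ be integers, $d=\min(m,n)$, and let $\|\cdot\|$ be a norm (the source norm) on the space $\mathcal{M}_{m,n}$ of real $m\times n$ matrices, with associated sequence $\big(\|\cdot\|_{(r)}^{\mathrm{rk}}\big)_{r\in\{1,\dots,d\}}$ of generalized $r$-rank matrix norms. Then, for every $M\in\mathcal{M}_{m,n}\setminus\{0\}$, $$ \mathrm{rk}(M)\;\ge\;\frac{1}{\|M\|}\;\min_{\substack{M^{(1)}\in\mathcal{M}_{m,n},\,\ldots,\,M^{(d)}\in\mathcal{M}_{m,n}\\ \sum_{r=1}^{d}\|M^{(r)}\|_{(r)}^{\mathrm{rk}}\le \|M\|\\ \sum_{r=1}^{d}M^{(r)}=M}}\;\sum_{r=1}^{d} r\,\|M^{(r)}\|_{(r)}^{\mathrm{rk}} . $$ Moreover, if the source norm is the Frobenius norm $\|M\|_F=\sqrt{\mathrm{Tr}(MM^{\mathrm T})}$, with associated generalized $r$-rank matrix norms $\|\cdot\|_{F,(r)}^{\mathrm{rk}}$, $r\in\{1,\dots,d\}$, then the inequality is an equality: for every $M\in\mathcal{M}_{m,n}\setminus\{0\}$, $$ \mathrm{rk}(M)\;=\;\frac{1}{\|M\|_F}\;\min_{\substack{M^{(1)}\in\mathcal{M}_{m,n},\,\ldots,\,M^{(d)}\in\mathcal{M}_{m,n}\\ \sum_{r=1}^{d}\|M^{(r)}\|_{F,(r)}^{\mathrm{rk}}\le \|M\|_F\\ \sum_{r=1}^{d}M^{(r)}=M}}\;\sum_{r=1}^{d} r\,\|M^{(r)}\|_{F,(r)}^{\mathrm{rk}}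 . $$
   Context: $\mathcal{M}_{m,n}$ is the space of real matrices with $m$ rows and $n$ columns, equipped with the scalar product $(M,N)\mapsto \mathrm{Tr}(MN^{\mathrm T})$; $\mathrm{rk}(M)$ is the rank of $M$. Norms on $\mathcal{M}_{m,n}$ are arbitrary vector-space norms (not required to be submultiplicative). The dual norm of a norm $\|\cdot\|$ on $\mathcal{M}_{m,n}$ is $\|N\|_\star=\sup_{\|M\|\le 1}\mathrm{Tr}(MN^{\mathrm T})$. Given a source norm $\|\cdot\|$ on $\mathcal{M}_{m,n}$ and $r\in\{1,\dots,d\}$, the generalized dual $r$-rank matrix norm is the norm on $\mathcal{M}_{m,n}$ defined by $$\|N\|_{(r),\star}^{\mathrm{rk}}=\sup\{\mathrm{Tr}(MN^{\mathrm T}) : M\in\mathcal{M}_{m,n},\ \|M\|\le 1,\ \mathrm{rk}(M)\le r\},$$ and the generalized $r$-rank matrix norm $\|\cdot\|_{(r)}^{\mathrm{rk}}$ is its dual norm: $\|\cdot\|_{(r)}^{\mathrm{rk}}=\big(\|\cdot\|_{(r),\star}^{\mathrm{rk}}\big)_\star$. The norms $\|\cdot\|_{F,(r)}^{\mathrm{rk}}$ are those obtained from this construction with source norm $\|\cdot\|_F$. *)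

theory Defs
  imports "HOL-Analysis.Analysis"
begin

text \<open>A matrix with \<open>m\<close> rows and \<open>n\<close> columns has type \<^typ>\<open>real^'n^'m\<close>, with
  \<open>m = CARD('m)\<close> and \<open>n = CARD('n)\<close>. The class-based \<^const>\<open>norm\<close> is one fixed norm on this
  type, so an arbitrary norm is a function satisfying the following predicate.\<close>

definition is_norm :: "('a::real_vector \<Rightarrow> real) \<Rightarrow> bool" where
  "is_norm \<nu> \<longleftrightarrow>
     (\<forall>x. 0 \<le> \<nu> x) \<and>
     (\<forall>x. \<nu> x = 0 \<longleftrightarrow> x = 0) \<and>
     (\<forall>c x. \<nu> (c *\<^sub>R x) = \<bar>c\<bar> * \<nu> x) \<and>
     (\<forall>x y. \<nu> (x + y) \<le> \<nu> x + \<nu> y)"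

definition frobenius_norm :: "real^'n^'m \<Rightarrow> real" where
  "frobenius_norm M = sqrt (trace (M ** transpose M))"

definition dual_norm :: "(real^'n^'m \<Rightarrow> real) \<Rightarrow> real^'n^'m \<Rightarrow> real" where
  "dual_norm \<nu> N = Sup {trace (M ** transpose N) | M. \<nu> M \<le> 1}"

definition gen_dual_rank_norm ::
    "(real^'n^'m \<Rightarrow> real) \<Rightarrow> nat \<Rightarrow> real^'n^'m \<Rightarrow> real" where
  "gen_dual_rank_norm \<nu> r N = Sup {trace (M ** transpose N) | M. \<nu> M \<le> 1 \<and> rank M \<le> r}"

definition gen_rank_norm ::
    "(real^'n^'m \<Rightarrow> real) \<Rightarrow> nat \<Rightarrow> real^'n^'m \<Rightarrow> real" where
  "gen_rank_norm \<nu> r = dual_norm (gen_dual_rank_norm \<nu> r)"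

text \<open>A tuple \<open>(M\<^sup>1, \<dots>, M\<^sup>d)\<close> of matrices is encoded as a function on \<^typ>\<open>nat\<close>;
  only its values on \<open>{1..d}\<close>, where \<open>d = min m n\<close>, are ever used.\<close>

definition feasible ::
    "(real^'n^'m \<Rightarrow> real) \<Rightarrow> real^'n^'m \<Rightarrow> (nat \<Rightarrow> real^'n^'m) \<Rightarrow> bool" where
  "feasible \<nu> M X \<longleftrightarrow>
     (\<Sum>r = 1..min CARD('m) CARD('n). gen_rank_norm \<nu> r (X r)) \<le> \<nu> M \<and>
     (\<Sum>r = 1..min CARD('m) CARD('n). X r) = M"

definition objective ::
    "(real^'n^'m \<Rightarrow> real) \<Rightarrow> (nat \<Rightarrow> real^'n^'m) \<Rightarrow> real" where
  "objective \<nu> X =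
     (\<Sum>r = 1..min CARD('m) CARD('n). real r * gen_rank_norm \<nu> r (X r))"

end

theory Submission
  imports Defs
begin

text \<open>
  Write \<open>D\<^sub>r\<close> for the generalized dual \<open>r\<close>-rank norm and \<open>G\<^sub>r\<close> for the generalized \<open>r\<close>-rank
  norm. For \<open>r \<ge> 1\<close> both are support functions of bounded symmetric sets that do not lie in a
  hyperplane, hence norms (\<open>is_norm_support_function\<close>; rank-one matrices provide the non-degeneracy of \<open>D\<^sub>r\<close>).
  Consequently, once the irrelevant components of a tuple are set to \<open>0\<close>, the feasible tuples form a
  compact set on which the objective is continuous, so the minimum is attained
  (\<open>ex_is_arg_min_objective\<close>).

  Upper bound: \<open>G\<^sub>r(M) \<le> \<nu>(M)\<close> whenever \<open>rank M \<le> r\<close>. So the tuple whose only nonzero component is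
  \<open>M\<close>, at position \<open>l = rank M\<close>, is feasible with objective at most \<open>l \<nu>(M)\<close>
  (\<open>ex_feasible_objective_le\<close>).

  Lower bound for the Frobenius norm \<open>|M|\<close>: always \<open>D\<^sub>r(M) \<le> |M|\<close>, and the inequality is strict if
  \<open>r < rank M\<close>, because the matrices of rank at most \<open>r\<close> then stay at a positive distance from \<open>M\<close>
  (\<open>gen_dual_rank_norm_frobenius_less\<close>). For a feasible tuple \<open>X\<close>, duality gives
    \<open>|M|\<^sup>2 = \<Sum>\<^sub>r \<langle>X\<^sub>r, M\<rangle> \<le> \<Sum>\<^sub>r G\<^sub>r(X\<^sub>r) D\<^sub>r(M) \<le> \<Sum>\<^sub>r G\<^sub>r(X\<^sub>r) |M| \<le> |M|\<^sup>2\<close>.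
  Equality throughout yields \<open>\<Sum>\<^sub>r G\<^sub>r(X\<^sub>r) = |M|\<close> and, by the strict inequality, \<open>G\<^sub>r(X\<^sub>r) = 0\<close> for
  \<open>r < l\<close>. Thus the objective \<open>\<Sum>\<^sub>r r G\<^sub>r(X\<^sub>r)\<close> is at least \<open>l |M|\<close>
  (\<open>rank_mult_frobenius_le_objective\<close>).
\<close>

section \<open>Norms on Euclidean spaces\<close>

lemma is_normD:
  assumes "is_norm \<nu>"
  shows is_norm_nonneg: "0 \<le> \<nu> x"
    and is_norm_eq_0_iff: "\<nu> x = 0 \<longleftrightarrow> x = 0"
    and is_norm_scaleR: "\<nu> (c *\<^sub>R x) = \<bar>c\<bar> * \<nu> x"
    and is_norm_triangle: "\<nu> (x + y) \<le> \<nu> x + \<nu> y"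
  using assms unfolding is_norm_def by auto

lemma is_norm_pos:
  assumes "is_norm \<nu>" "x \<noteq> 0"
  shows "0 < \<nu> x"
  using is_norm_nonneg[OF assms(1), of x] is_norm_eq_0_iff[OF assms(1), of x] assms(2) by linarith

lemma is_norm_minus:
  assumes "is_norm \<nu>"
  shows "\<nu> (- x) = \<nu> x"
  using is_norm_scaleR[OF assms, of "-1" x] by simp

lemma is_norm_continuous_on:
  fixes \<nu> :: "'a::euclidean_space \<Rightarrow> real"
  assumes "is_norm \<nu>"
  shows "continuous_on S \<nu>"
proof -
  have "convex_on UNIV \<nu>"
  proof (rule convex_onI)
    fix t :: real and x y :: 'a
    assume "0 < t" "t < 1"
    then show "\<nu> ((1 - t) *\<^sub>R x + t *\<^sub>R y) \<le> (1 - t) * \<nu> x + t * \<nu> y"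
      using is_norm_triangle[OF assms, of "(1 - t) *\<^sub>R x" "t *\<^sub>R y"]
      by (simp add: is_norm_scaleR[OF assms])
  qed simp
  then have "continuous_on UNIV \<nu>"
    by (intro convex_on_continuous) auto
  then show ?thesis
    using continuous_on_subset by blast
qed

text \<open>One half of the equivalence of norms in finite dimension: the constant is the minimum of \<open>\<nu>\<close> on
  the Euclidean unit sphere.\<close>

lemma is_norm_dominates_norm:
  fixes \<nu> :: "'a::euclidean_space \<Rightarrow> real"
  assumes "is_norm \<nu>"
  obtains c where "0 < c" "\<And>x. c * norm x \<le> \<nu> x"
proof -
  have "sphere (0::'a) 1 \<noteq> {}" by simp
  then obtain u where u: "u \<in> sphere (0::'a) 1" "\<And>x. x \<in> sphere 0 1 \<Longrightarrow> \<nu> u \<le> \<nu> x"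
    using continuous_attains_inf[OF compact_sphere _ is_norm_continuous_on[OF assms]] by blast
  have "\<nu> u * norm x \<le> \<nu> x" for x
  proof (cases "x = 0")
    case True
    then show ?thesis using is_norm_nonneg[OF assms, of x] by simp
  next
    case False
    then have "(inverse (norm x)) *\<^sub>R x \<in> sphere 0 1" by simp
    from u(2)[OF this] have "\<nu> u \<le> inverse (norm x) * \<nu> x"
      by (simp add: is_norm_scaleR[OF assms])
    then show ?thesis using False by (simp add: field_simps)
  qed
  moreover have "u \<noteq> 0" using u(1) by auto
  then have "0 < \<nu> u" by (rule is_norm_pos[OF assms])
  ultimately show ?thesis using that by blast
qed

lemma is_norm_bounded_unit_ball:
  fixes \<nu> :: "'a::euclidean_space \<Rightarrow> real"
  assumes "is_norm \<nu>"
  shows "bounded {x. \<nu> x \<le> 1}"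
proof -
  obtain c where c: "0 < c" "\<And>x. c * norm x \<le> \<nu> x"
    using is_norm_dominates_norm[OF assms] by blast
  have "norm x \<le> 1 / c" if "\<nu> x \<le> 1" for x
    using c(1) c(2)[of x] that by (simp add: field_simps)
  then show ?thesis by (auto simp: bounded_iff)
qed

section \<open>Support functions\<close>

text \<open>The support function of a set, in inner-product form. The supremum is meaningful only for
  nonempty sets on which the linear functional \<open>x \<mapsto> x \<bullet> y\<close> is bounded above; it is used for bounded
  sets containing \<open>0\<close>.\<close>

definition support_function :: "'a::real_inner set \<Rightarrow> 'a \<Rightarrow> real" where
  "support_function S y = (SUP x\<in>S. x \<bullet> y)"

lemma inner_le_support_function:
  assumes "bounded S" "x \<in> S"
  shows "x \<bullet> y \<le> support_function S y"
proof -
  obtain B where B: "\<And>x. x \<in> S \<Longrightarrow> norm x \<le> B"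
    using assms(1) by (auto simp: bounded_iff)
  have "x \<bullet> y \<le> B * norm y" if "x \<in> S" for x
    using norm_cauchy_schwarz[of x y] mult_right_mono[OF B[OF that], of "norm y"] by simp
  then have "bdd_above ((\<lambda>x. x \<bullet> y) ` S)" by (rule bdd_aboveI2)
  then show ?thesis
    unfolding support_function_def using assms(2) by (rule cSUP_upper[rotated])
qed

lemma support_function_le:
  assumes "S \<noteq> {}" "\<And>x. x \<in> S \<Longrightarrow> x \<bullet> y \<le> B"
  shows "support_function S y \<le> B"
  unfolding support_function_def using assms by (rule cSUP_least)

text \<open>Symmetry of the set gives absolute homogeneity, and the last hypothesis (no hyperplane through
  the origin contains the set) gives definiteness.\<close>

lemma is_norm_support_function:
  assumes "bounded S" "0 \<in> S"
    and sym: "\<And>x. x \<in> S \<Longrightarrow> - x \<in> S"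
    and pos: "\<And>y. y \<noteq> 0 \<Longrightarrow> \<exists>x\<in>S. 0 < x \<bullet> y"
  shows "is_norm (support_function S)"
proof -
  note upper = inner_le_support_function[OF assms(1)]
  have ne: "S \<noteq> {}" using assms(2) by blast
  have nonneg: "0 \<le> support_function S y" for y
    using upper[OF assms(2), of y] by simp
  have zero: "support_function S 0 = 0"
    using support_function_le[OF ne, of 0 0] nonneg[of 0] by simp
  have scale_le: "support_function S (c *\<^sub>R y) \<le> \<bar>c\<bar> * support_function S y" for c y
  proof (rule support_function_le[OF ne])
    fix x assume x: "x \<in> S"
    have "\<bar>x \<bullet> y\<bar> \<le> support_function S y"
      using upper[OF x, of y] upper[OF sym[OF x], of y] by simp
    then have "\<bar>c * (x \<bullet> y)\<bar> \<le> \<bar>c\<bar> * support_function S y"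
      by (simp add: abs_mult mult_left_mono)
    then show "x \<bullet> c *\<^sub>R y \<le> \<bar>c\<bar> * support_function S y"
      by simp
  qed
  have scale: "support_function S (c *\<^sub>R y) = \<bar>c\<bar> * support_function S y" for c y
  proof (cases "c = 0")
    case False
    have "support_function S y \<le> \<bar>inverse c\<bar> * support_function S (c *\<^sub>R y)"
      using scale_le[of "inverse c" "c *\<^sub>R y"] False by simp
    then have "\<bar>c\<bar> * support_function S y \<le> support_function S (c *\<^sub>R y)"
      using False by (simp add: field_simps)
    with scale_le[of c y] show ?thesis by simp
  qed (simp add: zero)
  have "support_function S (y + z) \<le> support_function S y + support_function S z" for y z
  proof (rule support_function_le[OF ne])
    fix x assume "x \<in> S"
    from upper[OF this, of y] upper[OF this, of z]
    show "x \<bullet> (y + z) \<le> support_function S y + support_function S z"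
      by (simp add: inner_add_right)
  qed
  moreover have "support_function S y = 0 \<longleftrightarrow> y = 0" for y
    using pos[of y] upper[of _ y] zero by force
  ultimately show ?thesis
    using nonneg scale by (simp add: is_norm_def)
qed

section \<open>Frobenius norm and rank\<close>

lemma trace_mult_transpose_eq_inner:
  fixes M N :: "real^'n^'m"
  shows "trace (M ** transpose N) = M \<bullet> N"
  by (simp add: trace_def matrix_matrix_mult_def transpose_def inner_vec_def)

lemma frobenius_norm_eq_norm: "frobenius_norm M = norm M"
  by (simp add: frobenius_norm_def trace_mult_transpose_eq_inner norm_eq_sqrt_inner)

lemma is_norm_frobenius_norm: "is_norm (frobenius_norm :: real^'n^'m \<Rightarrow> real)"
  by (simp add: is_norm_def frobenius_norm_eq_norm norm_triangle_ineq)

lemma rank_scaleR_le: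
  fixes M :: "real^'n^'m"
  shows "rank (c *\<^sub>R M) \<le> rank M"
proof -
  have "(c *\<^sub>R M) *v x = M *v (c *\<^sub>R x)" for x
    by (simp add: scaleR_matrix_vector_assoc[symmetric] matrix_vector_mult_scaleR)
  then have "range (\<lambda>x. (c *\<^sub>R M) *v x) \<subseteq> range (\<lambda>x. M *v x)" by auto
  then show ?thesis
    unfolding rank_dim_range by (rule dim_subset)
qed

lemma rank_outer_product_le_1:
  fixes u :: "real^'m" and v :: "real^'n"
  shows "rank (\<chi> i j. u $ i * v $ j) \<le> 1"
proof -
  have "(\<chi> i j. u $ i * v $ j) *v x = (v \<bullet> x) *\<^sub>R u" for x
    by (simp add: vec_eq_iff matrix_vector_mult_def inner_vec_def sum_distrib_left mult_ac)
  then have "range (\<lambda>x. (\<chi> i j. u $ i * v $ j) *v x) \<subseteq> span {u}"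
    by (auto intro: span_mul span_base)
  then have "rank (\<chi> i j. u $ i * v $ j) \<le> dim {u}"
    unfolding rank_dim_range by (metis dim_subset dim_span)
  also have "\<dots> \<le> 1"
    using dim_le_card[of "{u}" "{u}"] by (auto intro: span_base)
  finally show ?thesis .
qed

lemma norm_matrix_vector_mult_le:
  fixes M :: "real^'n^'m"
  shows "norm (M *v x) \<le> norm M * norm x"
proof -
  have "norm (M *v x) = L2_set (\<lambda>i. \<bar>M $ i \<bullet> x\<bar>) UNIV"
    by (simp add: norm_vec_def matrix_vector_mul_component)
  also have "\<dots> \<le> L2_set (\<lambda>i. norm (M $ i) * norm x) UNIV"
    by (intro L2_set_mono) (simp_all add: Cauchy_Schwarz_ineq2)
  also have "\<dots> = norm M * norm x"
    by (simp add: norm_vec_def[of M] L2_set_left_distrib)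
  finally show ?thesis .
qed

text \<open>A matrix is injective on its row space, hence bounded below there; this survives perturbations
  of norm smaller than the bound.\<close>

lemma rank_lower_semicontinuous:
  fixes M :: "real^'n^'m"
  obtains \<epsilon> where "0 < \<epsilon>" "\<And>N. norm (N - M) < \<epsilon> \<Longrightarrow> rank M \<le> rank N"
proof -
  let ?V = "span (rows M)"
  have "\<forall>x\<in>?V. M *v x = 0 \<longrightarrow> x = 0"
    using matrix_vector_mul_injective_on_rowspace[of M _ 0] span_zero by auto
  then obtain c where c: "0 < c" and lower: "\<And>x. x \<in> ?V \<Longrightarrow> c * norm x \<le> norm (M *v x)"
    using injective_imp_isometric[OF closed_subspace[OF subspace_span] subspace_span
        matrix_vector_mul_bounded_linear] by blast
  show ?thesis
  proof (rule that[OF c])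
    fix N :: "real^'n^'m"
    assume N: "norm (N - M) < c"
    have "x = 0" if x: "x \<in> ?V" "N *v x = 0" for x
    proof (rule ccontr)
      assume "x \<noteq> 0"
      have "(N - M) *v x = - (M *v x)"
        using x(2) by (simp add: matrix_vector_mult_diff_rdistrib)
      then have "c * norm x \<le> norm (N - M) * norm x"
        using lower[OF x(1)] norm_matrix_vector_mult_le[of "N - M" x] by simp
      with N \<open>x \<noteq> 0\<close> show False by simp
    qed
    then have "inj_on ((*v) N) ?V"
      by (subst linear_inj_on_iff_eq_0) (auto simp: subspace_span)
    then have "dim ((*v) N ` ?V) = dim ?V"
      by (intro dim_image_eq) (simp_all only: span_span matrix_vector_mul_linear)
    moreover have "dim ((*v) N ` ?V) \<le> rank N"
      unfolding rank_dim_range by (intro dim_subset) auto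
    ultimately show "rank M \<le> rank N" by (simp add: row_rank_def)
  qed
qed

section \<open>Generalized rank norms\<close>

lemma dual_norm_eq_support_function:
  "dual_norm \<nu> = support_function {M. \<nu> M \<le> 1}"
  by (rule ext) (simp add: dual_norm_def support_function_def image_def
      trace_mult_transpose_eq_inner conj_commute Bex_def)

lemma gen_dual_rank_norm_eq_support_function:
  "gen_dual_rank_norm \<nu> r = support_function {M. \<nu> M \<le> 1 \<and> rank M \<le> r}"
  by (rule ext) (simp add: gen_dual_rank_norm_def support_function_def image_def
      trace_mult_transpose_eq_inner conj_commute Bex_def)

lemma is_norm_dual_norm:
  fixes \<nu> :: "real^'n^'m \<Rightarrow> real"
  assumes "is_norm \<nu>"
  shows "is_norm (dual_norm \<nu>)"
  unfolding dual_norm_eq_support_function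
proof (rule is_norm_support_function)
  show "bounded {M. \<nu> M \<le> 1}" by (rule is_norm_bounded_unit_ball[OF assms])
  show "0 \<in> {M. \<nu> M \<le> 1}" using is_norm_eq_0_iff[OF assms, of 0] by simp
  show "- M \<in> {M. \<nu> M \<le> 1}" if "M \<in> {M. \<nu> M \<le> 1}" for M
    using that by (simp add: is_norm_minus[OF assms])
  fix N :: "real^'n^'m"
  assume N: "N \<noteq> 0"
  have "0 < \<nu> N" by (rule is_norm_pos[OF assms N])
  then show "\<exists>M\<in>{M. \<nu> M \<le> 1}. 0 < M \<bullet> N"
    using N by (intro bexI[of _ "inverse (\<nu> N) *\<^sub>R N"]) (simp_all add: is_norm_scaleR[OF assms])
qed

lemma is_norm_gen_dual_rank_norm:
  fixes \<nu> :: "real^'n^'m \<Rightarrow> real"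
  assumes "is_norm \<nu>" "1 \<le> r"
  shows "is_norm (gen_dual_rank_norm \<nu> r)"
  unfolding gen_dual_rank_norm_eq_support_function
proof (rule is_norm_support_function)
  let ?S = "{M. \<nu> M \<le> 1 \<and> rank M \<le> r}"
  show "bounded ?S"
    by (rule bounded_subset[OF is_norm_bounded_unit_ball[OF assms(1)]]) auto
  show "0 \<in> ?S" using is_norm_eq_0_iff[OF assms(1), of 0] by simp
  show "- M \<in> ?S" if "M \<in> ?S" for M
    using that rank_scaleR_le[of "-1" M] by (simp add: is_norm_minus[OF assms(1)])
  fix N :: "real^'n^'m"
  assume N: "N \<noteq> 0"
  then obtain i where i: "N $ i \<noteq> 0" by (auto simp: vec_eq_iff)
  \<comment> \<open>the rank-one matrix keeping only a nonzero row of \<open>N\<close>\<close>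
  define A :: "real^'n^'m" where "A = (\<chi> k j. axis i 1 $ k * N $ i $ j)"
  have "A \<bullet> N = (\<Sum>k\<in>UNIV. axis i 1 $ k * (N $ i \<bullet> N $ k))"
    by (simp add: A_def inner_vec_def sum_distrib_left mult_ac)
  also have "\<dots> = (\<Sum>k\<in>UNIV. if k = i then N $ i \<bullet> N $ k else 0)"
    by (intro sum.cong) (auto simp: axis_def)
  finally have AN: "A \<bullet> N = N $ i \<bullet> N $ i" by simp
  then have "A \<noteq> 0" using i by auto
  then have A: "0 < \<nu> A" by (rule is_norm_pos[OF assms(1)])
  have "rank A \<le> 1" unfolding A_def by (rule rank_outer_product_le_1)
  then have "rank (inverse (\<nu> A) *\<^sub>R A) \<le> r"
    using rank_scaleR_le[of "inverse (\<nu> A)" A] assms(2) by simp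
  then show "\<exists>M\<in>?S. 0 < M \<bullet> N"
    using A AN i by (intro bexI[of _ "inverse (\<nu> A) *\<^sub>R A"]) (simp_all add: is_norm_scaleR[OF assms(1)])
qed

lemma is_norm_gen_rank_norm:
  fixes \<nu> :: "real^'n^'m \<Rightarrow> real"
  assumes "is_norm \<nu>" "1 \<le> r"
  shows "is_norm (gen_rank_norm \<nu> r)"
  unfolding gen_rank_norm_def
  by (rule is_norm_dual_norm[OF is_norm_gen_dual_rank_norm[OF assms]])

text \<open>The generalized Cauchy--Schwarz inequality between a norm and its dual.\<close>

lemma inner_le_dual_norm:
  fixes \<nu> :: "real^'n^'m \<Rightarrow> real"
  assumes "is_norm \<nu>"
  shows "M \<bullet> N \<le> \<nu> M * dual_norm \<nu> N"
proof (cases "M = 0")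
  case True
  then show ?thesis using is_norm_eq_0_iff[OF assms, of 0] by simp
next
  case False
  then have pos: "0 < \<nu> M" by (rule is_norm_pos[OF assms])
  then have "inverse (\<nu> M) *\<^sub>R M \<in> {M. \<nu> M \<le> 1}"
    by (simp add: is_norm_scaleR[OF assms])
  from inner_le_support_function[OF is_norm_bounded_unit_ball[OF assms] this, of N]
  show ?thesis using pos by (simp add: dual_norm_eq_support_function field_simps)
qed

lemma inner_le_gen_rank_norm:
  fixes \<nu> :: "real^'n^'m \<Rightarrow> real"
  assumes "is_norm \<nu>" "1 \<le> r"
  shows "X \<bullet> M \<le> gen_rank_norm \<nu> r X * gen_dual_rank_norm \<nu> r M"
  using inner_le_dual_norm[OF is_norm_gen_dual_rank_norm[OF assms], of M X]
  by (simp add: gen_rank_norm_def inner_commute mult.commute)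

text \<open>On matrices of rank at most \<open>r\<close> the generalized \<open>r\<close>-rank norm is bounded by the source norm:
  such a matrix, once normalized, is admissible in the supremum defining the generalized dual norm.\<close>

lemma gen_rank_norm_le:
  fixes \<nu> :: "real^'n^'m \<Rightarrow> real"
  assumes "is_norm \<nu>" "1 \<le> r" "rank M \<le> r"
  shows "gen_rank_norm \<nu> r M \<le> \<nu> M"
proof (cases "M = 0")
  case True
  then show ?thesis
    using is_norm_eq_0_iff[OF assms(1), of 0] is_norm_eq_0_iff[OF is_norm_gen_rank_norm[OF assms(1,2)], of 0]
    by simp
next
  case False
  let ?D = "gen_dual_rank_norm \<nu> r"
  let ?S = "{M. \<nu> M \<le> 1 \<and> rank M \<le> r}"
  from False have pos: "0 < \<nu> M" by (rule is_norm_pos[OF assms(1)])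
  have bdd: "bounded ?S"
    by (rule bounded_subset[OF is_norm_bounded_unit_ball[OF assms(1)]]) auto
  have "inverse (\<nu> M) *\<^sub>R M \<in> ?S"
    using pos assms(3) rank_scaleR_le[of "inverse (\<nu> M)" M] by (simp add: is_norm_scaleR[OF assms(1)])
  from inner_le_support_function[OF bdd this]
  have *: "M \<bullet> N \<le> \<nu> M * ?D N" for N
    using pos by (simp add: gen_dual_rank_norm_eq_support_function field_simps)
  have "N \<bullet> M \<le> \<nu> M" if "?D N \<le> 1" for N
  proof -
    have "N \<bullet> M \<le> \<nu> M * ?D N" using *[of N] by (simp only: inner_commute)
    also have "\<dots> \<le> \<nu> M * 1" using that pos by (intro mult_left_mono) auto
    finally show ?thesis by simp
  qed
  moreover have "{N. ?D N \<le> 1} \<noteq> {}"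
    using is_norm_eq_0_iff[OF is_norm_gen_dual_rank_norm[OF assms(1,2)], of 0] by (auto intro!: exI[of _ 0])
  ultimately show ?thesis
    unfolding gen_rank_norm_def dual_norm_eq_support_function by (intro support_function_le) auto
qed

lemma gen_dual_rank_norm_frobenius_le:
  fixes M :: "real^'n^'m"
  shows "gen_dual_rank_norm frobenius_norm r M \<le> norm M"
  unfolding gen_dual_rank_norm_eq_support_function
proof (rule support_function_le)
  show "{M :: real^'n^'m. frobenius_norm M \<le> 1 \<and> rank M \<le> r} \<noteq> {}"
    by (auto simp: frobenius_norm_eq_norm intro!: exI[of _ 0])
  fix N :: "real^'n^'m"
  assume "N \<in> {M. frobenius_norm M \<le> 1 \<and> rank M \<le> r}"
  then have "norm N * norm M \<le> norm M"
    by (simp add: frobenius_norm_eq_norm mult_left_le_one_le)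
  then show "N \<bullet> M \<le> norm M"
    using norm_cauchy_schwarz[of N M] by linarith
qed

text \<open>If \<open>|N| \<le> 1\<close> and \<open>rank N \<le> r\<close>, then \<open>|M| N\<close> lies at distance at least \<open>\<epsilon>\<close> from \<open>M\<close>, where \<open>\<epsilon>\<close>
  comes from the lower semicontinuity of the rank. Expanding the square of this distance bounds
  \<open>N \<bullet> M\<close> away from \<open>|M|\<close>, uniformly in \<open>N\<close>; hence the supremum is strictly smaller too.\<close>

lemma gen_dual_rank_norm_frobenius_less:
  fixes M :: "real^'n^'m"
  assumes "r < rank M"
  shows "gen_dual_rank_norm frobenius_norm r M < norm M"
proof -
  obtain \<epsilon> where \<epsilon>: "0 < \<epsilon>" "\<And>N. norm (N - M) < \<epsilon> \<Longrightarrow> rank M \<le> rank N"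
    using rank_lower_semicontinuous[of M] by blast
  have "M \<noteq> 0" using assms by auto
  then have M: "0 < norm M" by simp
  have "gen_dual_rank_norm frobenius_norm r M \<le> norm M - \<epsilon>\<^sup>2 / (2 * norm M)"
    unfolding gen_dual_rank_norm_eq_support_function
  proof (rule support_function_le)
    show "{M :: real^'n^'m. frobenius_norm M \<le> 1 \<and> rank M \<le> r} \<noteq> {}"
      by (auto simp: frobenius_norm_eq_norm intro!: exI[of _ 0])
    fix N :: "real^'n^'m"
    assume "N \<in> {M. frobenius_norm M \<le> 1 \<and> rank M \<le> r}"
    then have N: "norm N \<le> 1" "rank N \<le> r" by (auto simp: frobenius_norm_eq_norm)
    let ?N = "norm M *\<^sub>R N"
    have "\<epsilon> \<le> norm (?N - M)"
      using \<epsilon>(2)[of ?N] rank_scaleR_le[of "norm M" N] N(2) assms by linarith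
    then have "\<epsilon>\<^sup>2 \<le> (norm (?N - M))\<^sup>2"
      using \<epsilon>(1) by (intro power_mono) auto
    also have "\<dots> = (norm M)\<^sup>2 * (norm N)\<^sup>2 - 2 * (norm M * (N \<bullet> M)) + (norm M)\<^sup>2"
      unfolding power2_norm_eq_inner[of "?N - M"] inner_diff_left inner_diff_right
      by (simp add: dot_square_norm inner_commute[of M N] power2_eq_square)
    also have "(norm M)\<^sup>2 * (norm N)\<^sup>2 \<le> (norm M)\<^sup>2"
      using N(1) by (simp add: mult_left_le power_le_one)
    finally show "N \<bullet> M \<le> norm M - \<epsilon>\<^sup>2 / (2 * norm M)"
      using M by (simp add: field_simps power2_eq_square)
  qed
  also have "\<dots> < norm M" using \<epsilon>(1) M by simp
  finally show ?thesis .
qed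

section \<open>Existence of a minimizer\<close>

text \<open>An instance of Tychonoff's theorem, for the product topology on the function type.\<close>

lemma compact_funcset_cball:
  fixes a :: "'b::euclidean_space"
  shows "compact {X :: 'i \<Rightarrow> 'b. \<forall>i. X i \<in> cball a C}"
proof -
  have "compactin (product_topology (\<lambda>_. euclidean) UNIV) (PiE UNIV (\<lambda>_::'i. cball a C))"
    by (simp add: compactin_PiE)
  moreover have "PiE UNIV (\<lambda>_::'i. cball a C) = {X. \<forall>i. X i \<in> cball a C}"
    by (auto simp: PiE_def)
  ultimately show ?thesis
    by (simp only: euclidean_product_topology compactin_euclidean_iff)
qed

text \<open>Feasibility bounds the components with index in \<open>{1..d}\<close>, but leaves the others free. Setting the
  latter to \<open>0\<close> changes neither feasibility nor the objective and leads into a compact set.\<close>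

lemma ex_is_arg_min_objective:
  fixes \<nu> :: "real^'n^'m \<Rightarrow> real"
  assumes "is_norm \<nu>" and Y: "feasible \<nu> M Y"
  shows "\<exists>X. is_arg_min (objective \<nu>) (feasible \<nu> M) X"
proof -
  let ?I = "{1..min CARD('m) CARD('n)}"
  let ?G = "gen_rank_norm \<nu>"
  have norm: "is_norm (?G r)" if "r \<in> ?I" for r
    using that by (intro is_norm_gen_rank_norm assms) auto
  have "\<exists>c>0. \<forall>x. c * norm x \<le> ?G r x" if "r \<in> ?I" for r
    using is_norm_dominates_norm[OF norm[OF that]] by metis
  then obtain c where c: "\<And>r. r \<in> ?I \<Longrightarrow> 0 < c r"
      "\<And>r x. r \<in> ?I \<Longrightarrow> c r * norm x \<le> ?G r x"
    by metis
  define C where "C = (\<Sum>r\<in>?I. \<nu> M / c r)"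
  have nonneg: "0 \<le> \<nu> M / c r" if "r \<in> ?I" for r
    using c(1)[OF that] is_norm_nonneg[OF assms(1), of M] by simp
  define K where "K = {X :: nat \<Rightarrow> real^'n^'m. \<forall>i. X i \<in> cball 0 C} \<inter> {X. feasible \<nu> M X}"
  define trunc where "trunc X = (\<lambda>r. if r \<in> ?I then X r else 0)" for X :: "nat \<Rightarrow> real^'n^'m"
  have trunc_obj: "objective \<nu> (trunc X) = objective \<nu> X" for X
    unfolding objective_def trunc_def by (intro sum.cong) auto
  have trunc_K: "trunc X \<in> K" if X: "feasible \<nu> M X" for X
  proof -
    have eq: "(\<Sum>r\<in>?I. ?G r (trunc X r)) = (\<Sum>r\<in>?I. ?G r (X r))"
        "(\<Sum>r\<in>?I. trunc X r) = (\<Sum>r\<in>?I. X r)"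
      by (auto simp: trunc_def intro!: sum.cong)
    have "norm (X r) \<le> C" if r: "r \<in> ?I" for r
    proof -
      have "?G r (X r) \<le> (\<Sum>r\<in>?I. ?G r (X r))"
        using r by (intro member_le_sum is_norm_nonneg[OF norm]) auto
      also have "\<dots> \<le> \<nu> M" using X by (simp add: feasible_def)
      finally have "c r * norm (X r) \<le> \<nu> M" using c(2)[OF r, of "X r"] by linarith
      then have "norm (X r) \<le> \<nu> M / c r" using c(1)[OF r] by (simp add: field_simps)
      also have "\<dots> \<le> C"
        unfolding C_def using r by (intro member_le_sum nonneg) auto
      finally show ?thesis .
    qed
    moreover have "0 \<le> C" unfolding C_def by (intro sum_nonneg nonneg)
    ultimately have "\<forall>i. trunc X i \<in> cball 0 C" by (simp add: trunc_def)
    moreover have "feasible \<nu> M (trunc X)" using X eq by (simp add: feasible_def)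
    ultimately show ?thesis by (simp add: K_def)
  qed
  have cont_coord: "continuous_on UNIV (\<lambda>X::nat \<Rightarrow> real^'n^'m. X r)" for r
    by simp
  have cont: "continuous_on UNIV (\<lambda>X::nat \<Rightarrow> real^'n^'m. ?G r (X r))" if "r \<in> ?I" for r
    by (rule continuous_on_compose2[OF is_norm_continuous_on[OF norm[OF that], of UNIV] cont_coord]) auto
  have "closed {X. feasible \<nu> M X}"
    unfolding feasible_def
    by (intro closed_Collect_conj closed_Collect_le closed_Collect_eq continuous_on_sum
        continuous_on_const cont cont_coord)
  then have "compact K"
    unfolding K_def by (intro compact_Int_closed compact_funcset_cball)
  moreover have "K \<noteq> {}" using trunc_K[OF Y] by blast
  moreover have "continuous_on K (objective \<nu>)"
  proof -
    have "continuous_on UNIV (objective \<nu>)"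
      unfolding objective_def[abs_def] by (intro continuous_on_sum continuous_on_mult continuous_on_const cont)
    then show ?thesis using continuous_on_subset by blast
  qed
  ultimately obtain X where X: "X \<in> K" "\<And>Z. Z \<in> K \<Longrightarrow> objective \<nu> X \<le> objective \<nu> Z"
    using continuous_attains_inf[of K "objective \<nu>"] by metis
  have "objective \<nu> X \<le> objective \<nu> Z" if "feasible \<nu> M Z" for Z
    using X(2)[OF trunc_K[OF that]] by (simp add: trunc_obj)
  moreover have "feasible \<nu> M X" using X(1) by (simp add: K_def)
  ultimately show ?thesis
    by (intro exI[of _ X]) (auto simp: is_arg_min_def not_less)
qed

section \<open>Bounds on the minimum\<close>

lemma ex_feasible_objective_le:
  fixes \<nu> :: "real^'n^'m \<Rightarrow> real"
  assumes "is_norm \<nu>" "M \<noteq> 0"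
  obtains Y where "feasible \<nu> M Y" "objective \<nu> Y \<le> real (rank M) * \<nu> M"
proof
  let ?I = "{1..min CARD('m) CARD('n)}"
  let ?Y = "\<lambda>r. if r = rank M then M else 0"
  have "rank M \<noteq> 0" using assms(2) by (simp add: rank_eq_0)
  then have mem: "rank M \<in> ?I" using rank_bound[of M] by (simp add: min.commute)
  have zero: "gen_rank_norm \<nu> r 0 = 0" if "r \<in> ?I" for r
    using is_norm_eq_0_iff[OF is_norm_gen_rank_norm[OF assms(1), of r], of 0] that by simp
  have G: "gen_rank_norm \<nu> (rank M) M \<le> \<nu> M"
    using mem by (intro gen_rank_norm_le assms) auto
  have "(\<Sum>r\<in>?I. gen_rank_norm \<nu> r (?Y r)) =
        (\<Sum>r\<in>?I. if r = rank M then gen_rank_norm \<nu> r M else 0)"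
    by (intro sum.cong) (auto simp: zero)
  also have "\<dots> = gen_rank_norm \<nu> (rank M) M" using mem by (simp del: atLeastAtMost_iff)
  moreover have "(\<Sum>r\<in>?I. ?Y r) = M" using mem by (simp del: atLeastAtMost_iff)
  ultimately show "feasible \<nu> M ?Y" using G by (simp add: feasible_def)
  have "objective \<nu> ?Y = (\<Sum>r\<in>?I. if r = rank M then real r * gen_rank_norm \<nu> r M else 0)"
    unfolding objective_def by (intro sum.cong) (auto simp: zero)
  also have "\<dots> = real (rank M) * gen_rank_norm \<nu> (rank M) M"
    using mem by (simp del: atLeastAtMost_iff)
  finally show "objective \<nu> ?Y \<le> real (rank M) * \<nu> M"
    using G by (simp add: mult_left_mono)
qed

text \<open>Every feasible tuple makes the chain of inequalities
  \<open>|M|\<^sup>2 \<le> \<Sum>\<^sub>r G\<^sub>r(X\<^sub>r) D\<^sub>r(M) \<le> \<Sum>\<^sub>r G\<^sub>r(X\<^sub>r) |M| \<le> |M|\<^sup>2\<close> tight, term by term. This plays the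
  role that strict convexity of the Euclidean ball would otherwise play.\<close>

lemma rank_mult_frobenius_le_objective:
  fixes M :: "real^'n^'m"
  assumes M: "M \<noteq> 0" and X: "feasible frobenius_norm M X"
  shows "real (rank M) * frobenius_norm M \<le> objective frobenius_norm X"
proof -
  let ?I = "{1..min CARD('m) CARD('n)}"
  define g where "g r = gen_rank_norm frobenius_norm r (X r)" for r
  define D where "D r = gen_dual_rank_norm frobenius_norm r M" for r
  have g_nonneg: "0 \<le> g r" if "r \<in> ?I" for r
    unfolding g_def using that
    by (intro is_norm_nonneg is_norm_gen_rank_norm is_norm_frobenius_norm) auto
  have D_le: "D r \<le> norm M" for r
    unfolding D_def by (rule gen_dual_rank_norm_frobenius_le)
  have sum_g_le: "(\<Sum>r\<in>?I. g r) \<le> norm M" and sum_X: "(\<Sum>r\<in>?I. X r) = M"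
    using X by (auto simp: feasible_def g_def frobenius_norm_eq_norm)
  have "norm M * norm M = (\<Sum>r\<in>?I. X r) \<bullet> M"
    unfolding sum_X by (simp add: dot_square_norm power2_eq_square)
  also have "\<dots> = (\<Sum>r\<in>?I. X r \<bullet> M)" by (rule inner_sum_left)
  also have "\<dots> \<le> (\<Sum>r\<in>?I. g r * D r)"
    unfolding g_def D_def
    by (intro sum_mono inner_le_gen_rank_norm is_norm_frobenius_norm) auto
  finally have lower: "norm M * norm M \<le> (\<Sum>r\<in>?I. g r * D r)" .
  have upper: "(\<Sum>r\<in>?I. g r * norm M) \<le> norm M * norm M"
    using mult_right_mono[OF sum_g_le, of "norm M"] by (simp add: sum_distrib_right)
  have mono: "g r * D r \<le> g r * norm M" if "r \<in> ?I" for r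
    using g_nonneg[OF that] D_le by (rule mult_left_mono[rotated])
  have sums: "(\<Sum>r\<in>?I. g r * D r) \<le> (\<Sum>r\<in>?I. g r * norm M)" by (intro sum_mono mono)
  have "(\<Sum>r\<in>?I. g r * norm M - g r * D r) = 0"
    using lower upper sums by (simp add: sum_subtractf)
  then have eq: "g r * norm M = g r * D r" if "r \<in> ?I" for r
    using that mono by (subst (asm) sum_nonneg_eq_0_iff) auto
  have "(\<Sum>r\<in>?I. g r) * norm M = norm M * norm M"
    using lower upper sums by (simp add: sum_distrib_right)
  then have sum_g: "(\<Sum>r\<in>?I. g r) = norm M" using M by simp
  have "real (rank M) * g r \<le> real r * g r" if r: "r \<in> ?I" for r
  proof (cases "r < rank M")
    case True
    then have "D r < norm M" unfolding D_def by (rule gen_dual_rank_norm_frobenius_less)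
    then have "g r = 0" using eq[OF r] by auto
    then show ?thesis by simp
  next
    case False
    then show ?thesis using g_nonneg[OF r] by (intro mult_right_mono) auto
  qed
  then have "(\<Sum>r\<in>?I. real (rank M) * g r) \<le> (\<Sum>r\<in>?I. real r * g r)" by (rule sum_mono)
  then show ?thesis
    unfolding sum_distrib_left[symmetric] sum_g
    by (simp add: frobenius_norm_eq_norm objective_def g_def)
qed

theorem theorem7:
  shows "(\<forall>\<nu> :: real^'n^'m \<Rightarrow> real. is_norm \<nu> \<longrightarrow>
            (\<forall>M. M \<noteq> 0 \<longrightarrow>
              (\<exists>X. is_arg_min (objective \<nu>) (feasible \<nu> M) X \<and>
                   real (rank M) \<ge> 1 / \<nu> M * objective \<nu> X))) \<and>
         (\<forall>M :: real^'n^'m. M \<noteq> 0 \<longrightarrow>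
              (\<exists>X. is_arg_min (objective frobenius_norm) (feasible frobenius_norm M) X \<and>
                   real (rank M) = 1 / frobenius_norm M * objective frobenius_norm X))"
proof -
  have general: "\<exists>X. is_arg_min (objective \<nu>) (feasible \<nu> M) X \<and>
                   real (rank M) \<ge> 1 / \<nu> M * objective \<nu> X"
    if \<nu>: "is_norm \<nu>" and M: "M \<noteq> 0" for \<nu> and M :: "real^'n^'m"
  proof -
    obtain Y where Y: "feasible \<nu> M Y" "objective \<nu> Y \<le> real (rank M) * \<nu> M"
      using ex_feasible_objective_le[OF \<nu> M] by blast
    obtain X where X: "is_arg_min (objective \<nu>) (feasible \<nu> M) X"
      using ex_is_arg_min_objective[OF \<nu> Y(1)] by blast
    then have "objective \<nu> X \<le> objective \<nu> Y" using Y(1) by (auto simp: is_arg_min_def not_less)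
    with Y(2) have "objective \<nu> X \<le> real (rank M) * \<nu> M" by linarith
    then have "1 / \<nu> M * objective \<nu> X \<le> real (rank M)"
      using is_norm_pos[OF \<nu> M] by (simp add: field_simps)
    with X show ?thesis by blast
  qed
  moreover have "\<exists>X. is_arg_min (objective frobenius_norm) (feasible frobenius_norm M) X \<and>
                   real (rank M) = 1 / frobenius_norm M * objective frobenius_norm X"
    if M: "M \<noteq> 0" for M :: "real^'n^'m"
  proof -
    obtain X where X: "is_arg_min (objective frobenius_norm) (feasible frobenius_norm M) X"
        "real (rank M) \<ge> 1 / frobenius_norm M * objective frobenius_norm X"
      using general[OF is_norm_frobenius_norm M] by blast
    have "feasible frobenius_norm M X" using X(1) by (simp add: is_arg_min_def)
    then have "real (rank M) * frobenius_norm M \<le> objective frobenius_norm X"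
      by (rule rank_mult_frobenius_le_objective[OF M])
    then have "real (rank M) \<le> 1 / frobenius_norm M * objective frobenius_norm X"
      using is_norm_pos[OF is_norm_frobenius_norm M] by (simp add: field_simps)
    with X show ?thesis by (intro exI[of _ X]) auto
  qed
  ultimately show ?thesis by blast
qed

end
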